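(* For every integer $n\ge 4$, the polynomial $$G_n=x_1^{2}x_2+x_1x_3+x_4+\sum_{j=5}^{n}x_j^{2}\in\mathbb{C}[x_1,\dots,x_n]$$ satisfies: (a) $\nabla G_n$ has no zeros on $\mathbb{C}^{n}$; (b) $U(G_n)\equiv 0$, i.e. $U(G_n)$ is the zero polynomial; (c) $G_n$ admits no nonzero constant translation direction, i.e. there is no $0\neq w\in\mathbb{C}^n$ with $D_wG_n\equiv 0$; in particular $G_n$ is not cylindrical.
   Context: For $f\in\mathbb{C}[x_1,\dots,x_n]$, $\nabla f$ denotes the gradient (column vector of first partial derivatives), $\operatorname{Hess} f$ the $n\times n$ Hessian matrix, and $\operatorname{adj}$ the adjugate matrix. Define the polynomial $$U(f)=(\nabla f)^{T}\,\operatorname{adj}(\operatorname{Hess} f)\,\nabla f .$$ (Equivalently, $U(f)=-\det B(f)$, where $B(f)=\begin{pmatrix}\operatorname{Hess} f & \nabla f\\ (\nabla f)^{T} & 0\end{pmatrix}$ is the bordered Hessian.) For $w\in\mathbb{C}^n$, $D_w f:=w\cdot\nabla f=\sum_{i=1}^n w_i\,\partial f/\partial x_i$. The polynomial $f$ is called cylindrical if it is independent of one variable after an invertible linear change of coordinates, i.e. there exists $A\in\mathrm{GL}_n(\mathbb{C})$ such that $f(Ax)\in\mathbb{C}[x_1,\dots,x_{n-1}]$. For $n=4$ the sum $\sum_{j=5}^{n}x_j^2$ is empty. *)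

theory Defs
  imports
    "HOL-Library.Poly_Mapping"
    "Jordan_Normal_Form.Determinant"
begin

(* Polynomials over 'a in countably many variables: finitely supported maps from monomials
   (exponent vectors) to coefficients, multiplied by convolution.  Variables are numbered from 0,
   in accordance with the indexing of vec and mat, so the variable x_i is X (i - 1), and
   'a[x_1, ..., x_n] is the subring poly_ring n. *)
type_synonym 'a mpoly = "(nat \<Rightarrow>\<^sub>0 nat) \<Rightarrow>\<^sub>0 'a"

definition Cst :: "'a::comm_ring_1 \<Rightarrow> 'a mpoly" where
  "Cst c = Poly_Mapping.single 0 c"

definition X :: "nat \<Rightarrow> 'a::comm_ring_1 mpoly" where
  "X i = Poly_Mapping.single (Poly_Mapping.single i 1) 1"

definition vars :: "'a::comm_ring_1 mpoly \<Rightarrow> nat set" where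
  "vars f = (\<Union>m\<in>Poly_Mapping.keys f. Poly_Mapping.keys m)"

definition poly_ring :: "nat \<Rightarrow> 'a::comm_ring_1 mpoly set" where
  "poly_ring n = {f. vars f \<subseteq> {..<n}}"

(* Only the entries x $ i with i in vars f are used. *)
definition eval_at :: "'a::comm_ring_1 vec \<Rightarrow> 'a mpoly \<Rightarrow> 'a" where
  "eval_at x f = (\<Sum>m\<in>Poly_Mapping.keys f. Poly_Mapping.lookup f m *
     (\<Prod>i\<in>Poly_Mapping.keys m. x $ i ^ Poly_Mapping.lookup m i))"

definition subst :: "'a::comm_ring_1 mpoly vec \<Rightarrow> 'a mpoly \<Rightarrow> 'a mpoly" where
  "subst s f = (\<Sum>m\<in>Poly_Mapping.keys f. Cst (Poly_Mapping.lookup f m) *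
     (\<Prod>i\<in>Poly_Mapping.keys m. s $ i ^ Poly_Mapping.lookup m i))"

(* The monomial subtraction is truncated, but where it truncates the coefficient is 0. *)
definition pdiff :: "nat \<Rightarrow> 'a::comm_ring_1 mpoly \<Rightarrow> 'a mpoly" where
  "pdiff i f = (\<Sum>m\<in>Poly_Mapping.keys f.
     Poly_Mapping.single (m - Poly_Mapping.single i 1)
       (of_nat (Poly_Mapping.lookup m i) * Poly_Mapping.lookup f m))"

definition grad :: "nat \<Rightarrow> 'a::comm_ring_1 mpoly \<Rightarrow> 'a mpoly vec" where
  "grad n f = vec n (\<lambda>i. pdiff i f)"

definition Hess :: "nat \<Rightarrow> 'a::comm_ring_1 mpoly \<Rightarrow> 'a mpoly mat" where
  "Hess n f = mat n n (\<lambda>(i, j). pdiff i (pdiff j f))"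

definition U :: "nat \<Rightarrow> 'a::comm_ring_1 mpoly \<Rightarrow> 'a mpoly" where
  "U n f = grad n f \<bullet> (adj_mat (Hess n f) *\<^sub>v grad n f)"

definition dir_deriv :: "nat \<Rightarrow> 'a::comm_ring_1 vec \<Rightarrow> 'a mpoly \<Rightarrow> 'a mpoly" where
  "dir_deriv n w f = map_vec Cst w \<bullet> grad n f"

(* The polynomial f(Ax). *)
definition lin_subst :: "nat \<Rightarrow> 'a::comm_ring_1 mat \<Rightarrow> 'a mpoly \<Rightarrow> 'a mpoly" where
  "lin_subst n A f = subst (map_mat Cst A *\<^sub>v vec n X) f"

definition cylindrical :: "nat \<Rightarrow> 'a::comm_ring_1 mpoly \<Rightarrow> bool" where
  "cylindrical n f \<longleftrightarrow>
     (\<exists>A\<in>carrier_mat n n. invertible_mat A \<and> lin_subst n A f \<in> poly_ring (n - 1))"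

definition G :: "nat \<Rightarrow> complex mpoly" where
  "G n = X 0 ^ 2 * X 1 + X 0 * X 2 + X 3 + (\<Sum>j\<in>{4..<n}. X j ^ 2)"

end

theory Submission
  imports Defs
begin

text \<open>With variables numbered from 0, component 3 of the gradient is the constant 1, so the gradient
  never vanishes. Column 3 of the Hessian is 0, and column 1 is 2 x_0 times column 2; so
  for each j the Hessian has a nonzero kernel vector with vanishing entry j. This makes every
  cofactor vanish, and with them the adjugate.
  A cylindrical polynomial is, as a function, invariant under translations in some direction w
  other than 0; differentiating along w gives D_w G = 0. Evaluating D_w G at 0 and at signed unit
  vectors shows that w = 0.\<close>

section \<open>Evaluation, substitution and differentiation of polynomials\<close>

text \<open>Single terms generate all polynomials additively, so a claim additive in
  \<open>f\<close>, such as multiplicativity of evaluation or the Leibniz rule, need only be checked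
  on terms.\<close>

lemma poly_mapping_single_add_induct [case_names single add]:
  fixes f :: "'a \<Rightarrow>\<^sub>0 'b::comm_monoid_add"
  assumes single: "\<And>m c. P (Poly_Mapping.single m c)"
    and add: "\<And>f g. P f \<Longrightarrow> P g \<Longrightarrow> P (f + g)"
  shows "P f"
proof (induction f rule: update_induct)
  case const
  show ?case using single[of undefined 0] by simp
next
  case (update f a b)
  have "Poly_Mapping.update a b f = f + Poly_Mapping.single a b"
    using update(1)
    by (intro poly_mapping_eqI) (auto simp: Poly_Mapping.update.rep_eq lookup_add lookup_single in_keys_iff when_def)
  then show ?case using add[OF update(3) single] by simp
qed

section \<open>Evaluation as a ring homomorphism\<close>

definition eval_monom :: "'a::comm_ring_1 vec \<Rightarrow> (nat \<Rightarrow>\<^sub>0 nat) \<Rightarrow> 'a" where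
  "eval_monom x m = (\<Prod>i\<in>Poly_Mapping.keys m. x $ i ^ Poly_Mapping.lookup m i)"

text \<open>Indices outside the keys contribute factors with exponent 0. This lets the products for
  \<open>a\<close>, \<open>b\<close> and \<open>a + b\<close> run over one index set.\<close>

lemma eval_monom_superset:
  assumes "finite S" "Poly_Mapping.keys m \<subseteq> S"
  shows "eval_monom x m = (\<Prod>i\<in>S. x $ i ^ Poly_Mapping.lookup m i)"
  unfolding eval_monom_def
  by (rule prod.mono_neutral_left) (use assms in \<open>auto simp: in_keys_iff\<close>)

lemma eval_monom_add: "eval_monom x (a + b) = eval_monom x a * eval_monom x b"
proof -
  let ?S = "Poly_Mapping.keys a \<union> Poly_Mapping.keys b"
  have "Poly_Mapping.keys (a + b) \<subseteq> ?S" by (rule keys_add)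
  then show ?thesis
    by (simp add: eval_monom_superset[of ?S] lookup_add power_add prod.distrib)
qed

lemma eval_at_eq: "eval_at x f = (\<Sum>m\<in>Poly_Mapping.keys f. Poly_Mapping.lookup f m * eval_monom x m)"
  by (simp add: eval_at_def eval_monom_def)

lemma eval_at_single [simp]: "eval_at x (Poly_Mapping.single m c) = c * eval_monom x m"
  by (simp add: eval_at_eq)

lemma eval_at_add [simp]: "eval_at x (f + g) = eval_at x f + eval_at x g"
  unfolding eval_at_eq by (rule setsum_keys_plus_distrib) (auto simp: distrib_right)

lemma eval_at_mult [simp]: "eval_at x (f * g) = eval_at x f * eval_at x g"
proof (induction f rule: poly_mapping_single_add_induct)
  case (single m c)
  show ?case
  proof (induction g rule: poly_mapping_single_add_induct)
    case (single k d)
    show ?case by (simp add: mult_single eval_monom_add)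
  qed (simp add: distrib_left)
qed (simp add: distrib_right)

lemma eval_at_Cst [simp]: "eval_at x (Cst c) = c"
  by (simp add: Cst_def eval_monom_def)

lemma eval_at_X [simp]: "eval_at x (X i) = x $ i"
  by (simp add: X_def eval_monom_def)

lemma eval_at_0 [simp]: "eval_at x 0 = 0"
  by (simp add: eval_at_def)

lemma eval_at_1 [simp]: "eval_at x 1 = 1"
  by (simp add: eval_at_eq eval_monom_def)

lemma eval_at_power [simp]: "eval_at x (f ^ k) = eval_at x f ^ k"
  by (induction k) auto

lemma eval_at_sum [simp]: "eval_at x (sum f S) = (\<Sum>i\<in>S. eval_at x (f i))"
  by (induction S rule: infinite_finite_induct) auto

lemma eval_at_prod [simp]: "eval_at x (prod f S) = (\<Prod>i\<in>S. eval_at x (f i))"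
  by (induction S rule: infinite_finite_induct) auto

text \<open>Expresses independence of a variable: moving a point along a coordinate that does not
  occur in \<open>f\<close> leaves the value unchanged.\<close>

lemma eval_at_cong:
  assumes "\<And>i. i \<in> vars f \<Longrightarrow> x $ i = y $ i"
  shows "eval_at x f = eval_at y f"
proof -
  have "x $ i = y $ i" if "m \<in> Poly_Mapping.keys f" "i \<in> Poly_Mapping.keys m" for m i
    using assms that by (auto simp: vars_def)
  then show ?thesis
    unfolding eval_at_def by simp
qed

text \<open>The bound on \<open>vars f\<close> keeps all indices in range, since
  \<open>map_vec\<close> determines entries only below the dimension.\<close>

lemma eval_at_subst:
  assumes "vars f \<subseteq> {..<dim_vec s}"
  shows "eval_at x (subst s f) = eval_at (map_vec (eval_at x) s) f"
proof -
  have "map_vec (eval_at x) s $ i = eval_at x (s $ i)"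
    if "m \<in> Poly_Mapping.keys f" "i \<in> Poly_Mapping.keys m" for m i
    using assms that by (auto simp: vars_def)
  then show ?thesis
    unfolding subst_def by (simp add: eval_at_def[of _ f])
qed

lemma eval_at_lin_subst:
  assumes "f \<in> poly_ring n" "A \<in> carrier_mat n n" "z \<in> carrier_vec n"
  shows "eval_at z (lin_subst n A f) = eval_at (A *\<^sub>v z) f"
proof -
  have "map_vec (eval_at z) (map_mat Cst A *\<^sub>v vec n X) = A *\<^sub>v z"
    using assms(2,3) by (intro eq_vecI) (auto simp: scalar_prod_def)
  then show ?thesis
    using assms by (simp add: lin_subst_def eval_at_subst poly_ring_def)
qed

section \<open>Formal partial derivatives\<close>

lemma pdiff_single:
  "pdiff i (Poly_Mapping.single m c)
    = Poly_Mapping.single (m - Poly_Mapping.single i 1) (of_nat (Poly_Mapping.lookup m i) * c)"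
  by (simp add: pdiff_def)

lemma pdiff_add: "pdiff i (f + g) = pdiff i f + pdiff i g"
  unfolding pdiff_def by (rule setsum_keys_plus_distrib) (auto simp: distrib_left single_add)

text \<open>The exponent of variable i in \<open>m\<close> is positive, so the subtraction does not
  truncate on either side.\<close>

lemma single_minus_add:
  fixes m k :: "nat \<Rightarrow>\<^sub>0 nat"
  assumes "Poly_Mapping.lookup m i \<noteq> 0"
  shows "m - Poly_Mapping.single i 1 + k = m + k - Poly_Mapping.single i 1"
  using assms
  by (intro poly_mapping_eqI) (auto simp: lookup_add lookup_minus lookup_single when_def)

lemma pdiff_mult: "pdiff i (f * g) = pdiff i f * g + f * pdiff i g"
proof (induction f rule: poly_mapping_single_add_induct)
  case (single m c)
  show ?case
  proof (induction g rule: poly_mapping_single_add_induct)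
    case (single k d)
    let ?e = "Poly_Mapping.single i 1 :: nat \<Rightarrow>\<^sub>0 nat"
    let ?a = "of_nat (Poly_Mapping.lookup m i) :: 'a" and ?b = "of_nat (Poly_Mapping.lookup k i) :: 'a"
    \<comment> \<open>If variable i is absent from \<open>m\<close>, the two exponents may differ
      through truncation, but then \<open>?a\<close> is 0 and both terms vanish.\<close>
    have "Poly_Mapping.single (m - ?e + k) (?a * c * d) = Poly_Mapping.single (m + k - ?e) (?a * c * d)"
      by (cases "Poly_Mapping.lookup m i = 0") (simp_all add: single_minus_add del: One_nat_def)
    moreover have "Poly_Mapping.single (m + (k - ?e)) (?b * c * d)
        = Poly_Mapping.single (m + k - ?e) (?b * c * d)"
      by (cases "Poly_Mapping.lookup k i = 0")
        (simp_all add: single_minus_add add.commute[of m] del: One_nat_def)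
    ultimately show ?case
      by (simp add: mult_single pdiff_single lookup_add distrib_right mult.assoc
          mult.left_commute[of c] flip: single_add)
  qed (simp add: algebra_simps pdiff_add)
qed (simp add: algebra_simps pdiff_add)

lemma pdiff_0 [simp]: "pdiff i 0 = 0"
  by (simp add: pdiff_def)

lemma pdiff_1 [simp]: "pdiff i 1 = 0"
  by (simp add: pdiff_def)

lemma pdiff_X [simp]: "pdiff i (X j) = (if i = j then 1 else 0)"
  by (simp add: X_def pdiff_single lookup_single when_def)

lemma pdiff_sum: "pdiff i (sum f S) = (\<Sum>k\<in>S. pdiff i (f k))"
  by (induction S rule: infinite_finite_induct) (auto simp: pdiff_add)

lemma dir_deriv_eq: "dir_deriv n w f = (\<Sum>i<n. Cst (w $ i) * pdiff i f)"
  if "w \<in> carrier_vec n"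
  using that by (simp add: dir_deriv_def grad_def scalar_prod_def lessThan_atLeast0)

lemma eval_at_dir_deriv:
  assumes "w \<in> carrier_vec n"
  shows "eval_at y (dir_deriv n w f) = (\<Sum>i<n. w $ i * eval_at y (pdiff i f))"
  using assms by (simp add: dir_deriv_eq)

section \<open>Closure properties of \<open>poly_ring n\<close>\<close>

lemma vars_add: "vars (f + g) \<subseteq> vars f \<union> vars g"
  using keys_add[of f g] by (auto simp: vars_def)

lemma vars_mult: "vars (f * g) \<subseteq> vars f \<union> vars g"
proof
  fix i assume "i \<in> vars (f * g)"
  then obtain m where "m \<in> Poly_Mapping.keys (f * g)" "i \<in> Poly_Mapping.keys m"
    by (auto simp: vars_def)
  moreover from this obtain a b where "m = a + b" "a \<in> Poly_Mapping.keys f" "b \<in> Poly_Mapping.keys g"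
    using keys_mult[of f g] by blast
  ultimately show "i \<in> vars f \<union> vars g"
    using keys_add[of a b] by (auto simp: vars_def)
qed

lemma poly_ring_add: "f \<in> poly_ring n \<Longrightarrow> g \<in> poly_ring n \<Longrightarrow> f + g \<in> poly_ring n"
  using vars_add[of f g] by (auto simp: poly_ring_def)

lemma poly_ring_mult: "f \<in> poly_ring n \<Longrightarrow> g \<in> poly_ring n \<Longrightarrow> f * g \<in> poly_ring n"
  using vars_mult[of f g] by (auto simp: poly_ring_def)

lemma poly_ring_X: "i < n \<Longrightarrow> X i \<in> poly_ring n"
  by (auto simp: poly_ring_def vars_def X_def)

lemma poly_ring_sum: "(\<And>i. i \<in> S \<Longrightarrow> f i \<in> poly_ring n) \<Longrightarrow> sum f S \<in> poly_ring n"
proof (induction S rule: infinite_finite_induct)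
  case (insert i S)
  then show ?case by (simp add: poly_ring_add)
qed (auto simp: poly_ring_def vars_def)

section \<open>Translation invariance and singular minors\<close>

text \<open>The direction is the last column of the coordinate change.\<close>

lemma cylindrical_imp_translation_invariant:
  assumes "cylindrical n f" "f \<in> poly_ring n" "n > 0"
  obtains w where "w \<in> carrier_vec n" "w \<noteq> 0\<^sub>v n"
    "\<And>y t. y \<in> carrier_vec n \<Longrightarrow> eval_at (y + t \<cdot>\<^sub>v w) f = eval_at y f"
proof -
  obtain A where A: "A \<in> carrier_mat n n" "invertible_mat A"
    and p: "lin_subst n A f \<in> poly_ring (n - 1)"
    using assms(1) by (auto simp: cylindrical_def)
  obtain B where "A * B = 1\<^sub>m (dim_row A)" and BA: "B * A = 1\<^sub>m (dim_row B)"
    using A(2) by (auto simp: invertible_mat_def inverts_mat_def)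
  then have AB: "A * B = 1\<^sub>m n"
    using A(1) by simp
  \<comment> \<open>The inverse comes without dimensions; comparing column counts in
    \<open>A * B = 1\<close> and \<open>B * A = 1\<close> shows that it is n by n.\<close>
  have "dim_col B = n" "dim_row B = n"
    using A(1) arg_cong[OF AB, of dim_col] arg_cong[OF BA, of dim_col] by simp_all
  with AB BA have Bc: "B \<in> carrier_mat n n" and B: "A * B = 1\<^sub>m n" "B * A = 1\<^sub>m n"
    by auto
  let ?e = "unit_vec n (n - 1) :: 'a vec"
  let ?w = "A *\<^sub>v ?e"
  show thesis
  proof
    show w: "?w \<in> carrier_vec n" using A(1) by simp
    have "B *\<^sub>v ?w = ?e"
      using A(1) B(2) Bc by (simp flip: assoc_mult_mat_vec[of B n n A n])
    moreover have "B *\<^sub>v 0\<^sub>v n = 0\<^sub>v n"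
      using Bc by (intro eq_vecI) auto
    moreover have "?e $ (n - 1) \<noteq> 0\<^sub>v n $ (n - 1)"
      using assms(3) by simp
    ultimately show "?w \<noteq> 0\<^sub>v n"
      by metis
    fix y :: "'a vec" and t assume y: "y \<in> carrier_vec n"
    \<comment> \<open>The point \<open>y\<close> in the new coordinates, where moving along
      \<open>?w\<close> becomes moving along the last axis.\<close>
    let ?z = "B *\<^sub>v y"
    have z: "?z \<in> carrier_vec n" using Bc y by (rule mult_mat_vec_carrier)
    have Az: "A *\<^sub>v ?z = y"
      using A(1) B(1) Bc y by (simp flip: assoc_mult_mat_vec[of A n n B n])
    have "A *\<^sub>v (t \<cdot>\<^sub>v ?e) = t \<cdot>\<^sub>v ?w"
      using A(1) by (intro eq_vecI) auto
    then have "A *\<^sub>v (?z + t \<cdot>\<^sub>v ?e) = y + t \<cdot>\<^sub>v ?w"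
      using A(1) z Az by (simp add: mult_add_distrib_mat_vec[of A n n])
    then have "eval_at (y + t \<cdot>\<^sub>v ?w) f = eval_at (?z + t \<cdot>\<^sub>v ?e) (lin_subst n A f)"
      using eval_at_lin_subst[OF assms(2) A(1), of "?z + t \<cdot>\<^sub>v ?e"] z by simp
    \<comment> \<open>Only entry n - 1 differs between the two points, and that variable does not
      occur in the transformed polynomial.\<close>
    also have "\<dots> = eval_at ?z (lin_subst n A f)"
      using p z Bc by (intro eval_at_cong) (auto simp: poly_ring_def)
    also have "\<dots> = eval_at y f"
      using eval_at_lin_subst[OF assms(2) A(1) z] Az by simp
    finally show "eval_at (y + t \<cdot>\<^sub>v ?w) f = eval_at y f" .
  qed
qed

text \<open>The cofactor is the determinant of the matrix in which row i is replaced by the unit vector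
  at j; the given kernel vector survives this replacement.\<close>

lemma cofactor_eq_0_if_kernel:
  fixes A :: "'a::idom mat"
  assumes A: "A \<in> carrier_mat n n" and ij: "i < n" "j < n"
    and v: "v \<in> carrier_vec n" "v \<noteq> 0\<^sub>v n" "v $ j = 0" "A *\<^sub>v v = 0\<^sub>v n"
  shows "cofactor A i j = 0"
proof -
  define B where "B = mat n n (\<lambda>(k, l). if k = i then (if l = j then 1 else 0) else A $$ (k, l))"
  have B: "B \<in> carrier_mat n n" by (simp add: B_def)
  have "(B *\<^sub>v v) $ k = 0" if k: "k < n" for k
  proof (cases "k = i")
    case True
    then have "(B *\<^sub>v v) $ k = (\<Sum>l<n. (if l = j then 1 else 0) * v $ l)"
      using v(1) k by (simp add: B_def scalar_prod_def lessThan_atLeast0)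
    also have "\<dots> = 0"
      using v(3) by (intro sum.neutral) auto
    finally show ?thesis .
  next
    case False
    then have "row B k = row A k"
      using A k by (intro eq_vecI) (auto simp: B_def)
    then show ?thesis
      using A B v(4) k by (metis carrier_matD(1) index_mult_mat_vec index_zero_vec(1))
  qed
  then have "B *\<^sub>v v = 0\<^sub>v n"
    using B by (intro eq_vecI) auto
  then have "det B = 0"
    using det_0_iff_vec_prod_zero[OF B] v by blast
  moreover have "det B = (\<Sum>l<n. B $$ (i, l) * cofactor B i l)"
    by (rule laplace_expansion_row[OF B ij(1)])
  moreover have "\<dots> = (\<Sum>l<n. if l = j then cofactor B i l else 0)"
    using ij by (intro sum.cong) (auto simp: B_def)
  \<comment> \<open>Only row i was altered, and the minor deletes it. The expansion of
    \<open>det B\<close> along row i therefore reduces to \<open>cofactor A i j\<close>.\<close>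
  moreover have "mat_delete B i j = mat_delete A i j"
    using A ij by (intro eq_matI) (auto simp: mat_delete_def B_def)
  ultimately show ?thesis
    using ij by (simp add: cofactor_def)
qed

section \<open>The polynomial G\<close>

lemma G_in_poly_ring: "n \<ge> 4 \<Longrightarrow> G n \<in> poly_ring n"
  unfolding G_def power2_eq_square
  by (intro poly_ring_add poly_ring_mult poly_ring_sum poly_ring_X) auto

lemma pdiff_G:
  "pdiff i (G n) = (if i = 0 then 2 * X 0 * X 1 + X 2 else 0) + (if i = 1 then X 0 ^ 2 else 0)
     + (if i = 2 then X 0 else 0) + (if i = 3 then 1 else 0)
     + (if i \<in> {4..<n} then 2 * X i else 0)"
proof -
  have "(\<Sum>j\<in>{4..<n}. pdiff i (X j * X j)) = (\<Sum>j\<in>{4..<n}. if j = i then 2 * X j else (0 :: complex mpoly))"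
    by (intro sum.cong) (auto simp: pdiff_mult)
  also have "\<dots> = (if i \<in> {4..<n} then 2 * X i else 0)"
    by (simp add: sum.delta')
  finally show ?thesis
    by (simp add: G_def power2_eq_square pdiff_add pdiff_mult pdiff_sum)
qed

section \<open>Vanishing of the adjugate of the Hessian\<close>

lemma U_G_eq_0:
  assumes "n \<ge> 4"
  shows "U n (G n) = 0"
proof -
  let ?H = "Hess n (G n)"
  have H: "?H \<in> carrier_mat n n" by (simp add: Hess_def)
  have "cofactor ?H i j = 0" if "i < n" "j < n" for i j
  proof (cases "j = 3")
    case True
    \<comment> \<open>Columns 1 and 2 are nonzero only in row 0, with entries \<open>2 * X 0\<close>
      and 1; this combination cancels them and has entry 3 equal to 0.\<close>
    let ?v = "vec n (\<lambda>k. if k = 1 then 1 else if k = 2 then - 2 * X 0 else 0) :: complex mpoly vec"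
    have "?v $ 1 \<noteq> 0\<^sub>v n $ 1" using assms by simp
    then have v0: "?v \<noteq> 0\<^sub>v n" by metis
    have "(?H *\<^sub>v ?v) $ k = 0" if k: "k < n" for k
    proof -
      have "(?H *\<^sub>v ?v) $ k = (\<Sum>l<n. pdiff k (pdiff l (G n)) *
          (if l = 1 then 1 else if l = 2 then - 2 * X 0 else 0))"
        using k by (simp add: Hess_def scalar_prod_def lessThan_atLeast0)
      also have "\<dots> = (\<Sum>l\<in>{1, 2}. pdiff k (pdiff l (G n)) * (if l = 1 then 1 else - 2 * X 0))"
        using assms by (intro sum.mono_neutral_cong_right) auto
      also have "\<dots> = 0"
        by (simp add: pdiff_G power2_eq_square pdiff_mult)
      finally show ?thesis .
    qed
    then have "?H *\<^sub>v ?v = 0\<^sub>v n"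
      using H by (intro eq_vecI) auto
    then show ?thesis
      using that True assms by (intro cofactor_eq_0_if_kernel[OF H _ _ _ v0]) auto
  next
    case False
    \<comment> \<open>Variable 3 occurs only linearly and alone, so column 3 is 0; the entry of this
      vector at j is 0 because j differs from 3.\<close>
    have "?H *\<^sub>v unit_vec n 3 = 0\<^sub>v n"
      using assms by (intro eq_vecI) (auto simp: Hess_def pdiff_G)
    then show ?thesis
      using that False assms
      by (intro cofactor_eq_0_if_kernel[OF H, where v = "unit_vec n 3"]) (auto simp: unit_vec_nonzero)
  qed
  then have "adj_mat ?H = 0\<^sub>m n n"
    using H by (intro eq_matI) (auto simp: adj_mat_def)
  then show ?thesis
    by (simp add: U_def grad_def scalar_prod_def)
qed

section \<open>Directional derivatives of G\<close>

lemma eval_at_pdiff_G: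
  "eval_at y (pdiff i (G n)) = (if i = 0 then 2 * y $ 0 * y $ 1 + y $ 2 else 0)
     + (if i = 1 then (y $ 0)\<^sup>2 else 0) + (if i = 2 then y $ 0 else 0) + (if i = 3 then 1 else 0)
     + (if i \<in> {4..<n} then 2 * y $ i else 0)"
proof -
  \<comment> \<open>The inner numeral is a constant polynomial, evaluated as 1 + 1.\<close>
  have "eval_at y 2 = 2"
    using eval_at_add[of y 1 1] by simp
  then show ?thesis
    by (simp add: pdiff_G)
qed

lemma eval_at_dir_deriv_G:
  assumes "n \<ge> 4" "w \<in> carrier_vec n"
  shows "eval_at y (dir_deriv n w (G n)) = w $ 0 * (2 * y $ 0 * y $ 1 + y $ 2) + w $ 1 * (y $ 0)\<^sup>2
     + w $ 2 * y $ 0 + w $ 3 + (\<Sum>j\<in>{4..<n}. 2 * w $ j * y $ j)"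
proof -
  have split: "{..<n} = {0, 1, 2, 3} \<union> {4..<n}"
    using assms(1) by auto
  show ?thesis
    unfolding eval_at_dir_deriv[OF assms(2)] split
    by (subst sum.union_disjoint) (auto simp: eval_at_pdiff_G algebra_simps intro!: sum.cong)
qed

text \<open>Vanishing is assumed pointwise, so that the lemma serves both the polynomial identity
  \<open>dir_deriv n w (G n) = 0\<close> and the derivatives along lines in the cylindrical
  case.\<close>

lemma direction_eq_0:
  assumes n: "n \<ge> 4" and w: "w \<in> carrier_vec n"
    and D: "\<And>y. y \<in> carrier_vec n \<Longrightarrow> eval_at y (dir_deriv n w (G n)) = 0"
  shows "w = 0\<^sub>v n"
proof -
  note E = D[unfolded eval_at_dir_deriv_G[OF n w]]
  have w3: "w $ 3 = 0"
    using E[of "0\<^sub>v n"] n by simp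
  \<comment> \<open>The coefficient of \<open>w $ 1\<close> is even in \<open>y $ 0\<close> and that
    of \<open>w $ 2\<close> is odd, so two opposite points separate them.\<close>
  have "w $ 1 + w $ 2 = 0"
    using E[of "unit_vec n 0"] n w3 by simp
  moreover have "w $ 1 - w $ 2 = 0"
    using E[of "- unit_vec n 0"] n w3 by simp
  ultimately have w12: "w $ 1 = 0" "w $ 2 = 0"
    by (simp_all add: algebra_simps eq_neg_iff_add_eq_0)
  have w0: "w $ 0 = 0"
    using E[of "unit_vec n 2"] n w3 by simp
  have "w $ k = 0" if k: "k \<in> {4..<n}" for k
  proof -
    have "(\<Sum>j\<in>{4..<n}. 2 * w $ j * unit_vec n k $ j) = (\<Sum>j\<in>{4..<n}. if j = k then 2 * w $ j else 0)"
      using k by (intro sum.cong) auto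
    then show ?thesis
      using E[of "unit_vec n k"] k w0 w12 w3 by simp
  qed
  then have "w $ k = 0" if "k < n" for k
    using that w0 w12 w3 by (cases "k = 0 \<or> k = 1 \<or> k = 2 \<or> k = 3") auto
  then show ?thesis
    using w by (intro eq_vecI) auto
qed

text \<open>Links the formal \<open>dir_deriv\<close> to the analytic derivative along a line, by
  differentiating the explicit formula for G and comparing with
  \<open>eval_at_dir_deriv_G\<close>.\<close>

lemma has_field_derivative_G:
  assumes "n \<ge> 4" "w \<in> carrier_vec n" "y \<in> carrier_vec n"
  shows "((\<lambda>t. eval_at (y + t \<cdot>\<^sub>v w) (G n)) has_field_derivative eval_at y (dir_deriv n w (G n))) (at 0)"
proof -
  have "(\<lambda>t. eval_at (y + t \<cdot>\<^sub>v w) (G n)) = (\<lambda>t. (y $ 0 + t * w $ 0)\<^sup>2 * (y $ 1 + t * w $ 1)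
      + (y $ 0 + t * w $ 0) * (y $ 2 + t * w $ 2) + (y $ 3 + t * w $ 3)
      + (\<Sum>j\<in>{4..<n}. (y $ j + t * w $ j)\<^sup>2))"
    using assms by (simp add: G_def)
  then show ?thesis
    unfolding eval_at_dir_deriv_G[OF assms(1,2)]
    by (auto intro!: derivative_eq_intros sum.cong simp: algebra_simps power2_eq_square)
qed

theorem proposition9:
  fixes n :: nat
  assumes "n \<ge> 4"
  shows "G n \<in> poly_ring n
    \<and> \<not> (\<exists>x\<in>carrier_vec n. map_vec (eval_at x) (grad n (G n)) = 0\<^sub>v n)
    \<and> U n (G n) = 0
    \<and> \<not> (\<exists>w\<in>carrier_vec n. w \<noteq> 0\<^sub>v n \<and> dir_deriv n w (G n) = 0)
    \<and> \<not> cylindrical n (G n)"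
proof (intro conjI)
  show "G n \<in> poly_ring n" by (rule G_in_poly_ring[OF assms])
  show "U n (G n) = 0" by (rule U_G_eq_0[OF assms])
  show "\<not> (\<exists>x\<in>carrier_vec n. map_vec (eval_at x) (grad n (G n)) = 0\<^sub>v n)"
  proof (intro notI, elim bexE)
    fix x assume "map_vec (eval_at x) (grad n (G n)) = 0\<^sub>v n"
    then have "map_vec (eval_at x) (grad n (G n)) $ 3 = 0"
      using assms by simp
    then show False
      using assms by (simp add: grad_def eval_at_pdiff_G)
  qed
  show "\<not> (\<exists>w\<in>carrier_vec n. w \<noteq> 0\<^sub>v n \<and> dir_deriv n w (G n) = 0)"
    using direction_eq_0[OF assms] by auto
  show "\<not> cylindrical n (G n)"
  proof
    assume cyl: "cylindrical n (G n)"
    have "n > 0" using assms by simp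
    with cyl obtain w where w: "w \<in> carrier_vec n" "w \<noteq> 0\<^sub>v n"
      and inv: "\<And>y t. y \<in> carrier_vec n \<Longrightarrow> eval_at (y + t \<cdot>\<^sub>v w) (G n) = eval_at y (G n)"
      using cylindrical_imp_translation_invariant[OF _ G_in_poly_ring[OF assms]] by metis
    have "eval_at y (dir_deriv n w (G n)) = 0" if y: "y \<in> carrier_vec n" for y
    proof -
      \<comment> \<open>Invariance makes the function of t constant, so uniqueness of derivatives
        forces the value 0.\<close>
      have "((\<lambda>t. eval_at y (G n)) has_field_derivative eval_at y (dir_deriv n w (G n))) (at 0)"
        using has_field_derivative_G[OF assms w(1) y] inv[OF y] by simp
      then show ?thesis
        using DERIV_const DERIV_unique by blast
    qed
    then show False
      using direction_eq_0[OF assms w(1)] w(2) by blast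
  qed
qed

end
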